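(* Let $X$ be a Banach space of analytic functions on $\mathbb{D}$ and let $T\in\mathcal{L}(H(\mathbb{D}))$ satisfy $T(X)\subseteq X$. Suppose that $([T,X],\|\cdot\|_{[T,X]})$ is a Banach space. Then, amongst all $(T,X)$-admissible spaces, the optimal domain space $[T,X]$ is the largest one; that is, $[T,X]$ is itself a $(T,X)$-admissible space and every $(T,X)$-admissible space $Z$ satisfies $Z\subseteq [T,X]$.
   Context: $\mathbb{D}$ is the open unit disc in $\mathbb{C}$; $H(\mathbb{D})$ is the Fréchet space of all analytic functions on $\mathbb{D}$ with the topology of uniform convergence on compact subsets of $\mathbb{D}$; $\mathcal{L}(E)$ denotes the space of continuous linear operators from $E$ into itself. A Banach space of analytic functions on $\mathbb{D}$ is a vector subspace $X\subseteq H(\mathbb{D})$ which is a Banach space for a norm $\|\cdot\|_X$ and such that the natural inclusion $X\to H(\mathbb{D})$ is continuous. For $T\in\mathcal{L}(H(\mathbb{D}))$ with $T(X)\subseteq X$, the optimal domain is $[T,X]:=\{f\in H(\mathbb{D}): Tf\in X\}$, endowed with the semi-norm $\|f\|_{[T,X]}:=\|Tf\|_X$. A Banach space $Z$ of analytic functions on $\mathbb{D}$ is called $(T,X)$-admissible if $T(Z)\subseteq X\subseteq Z$. *)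

theory Defs
  imports "HOL-Analysis.Analysis" "HOL-Library.Function_Algebras"
begin

text \<open>Functions on the open unit disc are total functions vanishing off the disc, so that
  equality of such functions is equality on the disc and pointwise operations are inherited
  from the function type.\<close>

definition unit_disc :: "complex set"
  where "unit_disc = ball 0 1"

definition HD :: "(complex \<Rightarrow> complex) set"
  where "HD = {f. f holomorphic_on unit_disc \<and> (\<forall>z. z \<notin> unit_disc \<longrightarrow> f z = 0)}"

definition cscale :: "complex \<Rightarrow> (complex \<Rightarrow> complex) \<Rightarrow> complex \<Rightarrow> complex"
  where "cscale c f = (\<lambda>z. c * f z)"

interpretation cfun: vector_space cscale
  by unfold_locales (simp_all add: cscale_def fun_eq_iff ring_distribs mult.assoc)

text \<open>Uniform convergence on compact subsets of the disc: the basic neighbourhoods of \<open>f\<close> are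
  the sets of all \<open>g\<close> that are \<open>e\<close>-close to \<open>f\<close> on a compact \<open>K\<close>.\<close>

definition HD_nbhd :: "(complex \<Rightarrow> complex) \<Rightarrow> complex set \<Rightarrow> real \<Rightarrow> (complex \<Rightarrow> complex) set"
  where "HD_nbhd f K e = {g \<in> HD. \<forall>z\<in>K. cmod (g z - f z) < e}"

definition HD_topology :: "(complex \<Rightarrow> complex) topology"
  where "HD_topology = topology (\<lambda>U. U \<subseteq> HD \<and>
    (\<forall>f\<in>U. \<exists>K e. compact K \<and> K \<subseteq> unit_disc \<and> e > 0 \<and> HD_nbhd f K e \<subseteq> U))"

lemma openin_HD_topology:
  "openin HD_topology U \<longleftrightarrow> U \<subseteq> HD \<and>
    (\<forall>f\<in>U. \<exists>K e. compact K \<and> K \<subseteq> unit_disc \<and> e > 0 \<and> HD_nbhd f K e \<subseteq> U)"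
proof -
  let ?P = "\<lambda>U. U \<subseteq> HD \<and>
    (\<forall>f\<in>U. \<exists>K e. compact K \<and> K \<subseteq> unit_disc \<and> e > 0 \<and> HD_nbhd f K e \<subseteq> U)"
  have "istopology ?P"
    unfolding istopology_def
  proof (intro conjI allI impI)
    fix S U assume S: "?P S" and U: "?P U"
    show "S \<inter> U \<subseteq> HD" using S by blast
    show "\<forall>f\<in>S \<inter> U. \<exists>K e. compact K \<and> K \<subseteq> unit_disc \<and> e > 0 \<and> HD_nbhd f K e \<subseteq> S \<inter> U"
    proof
      fix f assume f: "f \<in> S \<inter> U"
      obtain K d where K: "compact K" "K \<subseteq> unit_disc" "d > 0" "HD_nbhd f K d \<subseteq> S"
        using S f by blast
      obtain L e where L: "compact L" "L \<subseteq> unit_disc" "e > 0" "HD_nbhd f L e \<subseteq> U"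
        using U f by blast
      have "HD_nbhd f (K \<union> L) (min d e) \<subseteq> HD_nbhd f K d \<inter> HD_nbhd f L e"
        by (auto simp: HD_nbhd_def)
      then have "HD_nbhd f (K \<union> L) (min d e) \<subseteq> S \<inter> U"
        using K(4) L(4) by blast
      moreover have "compact (K \<union> L)" "K \<union> L \<subseteq> unit_disc" "min d e > 0"
        using K L by (simp_all add: compact_Un)
      ultimately show "\<exists>K e. compact K \<and> K \<subseteq> unit_disc \<and> e > 0 \<and> HD_nbhd f K e \<subseteq> S \<inter> U"
        by meson
    qed
  next
    fix \<U> assume U: "\<forall>U\<in>\<U>. ?P U"
    show "\<Union>\<U> \<subseteq> HD" using U by blast
    show "\<forall>f\<in>\<Union>\<U>. \<exists>K e. compact K \<and> K \<subseteq> unit_disc \<and> e > 0 \<and> HD_nbhd f K e \<subseteq> \<Union>\<U>"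
    proof
      fix f assume "f \<in> \<Union>\<U>"
      then obtain S where f: "f \<in> S" "S \<in> \<U>" by blast
      obtain K e where K: "compact K" "K \<subseteq> unit_disc" "e > 0" "HD_nbhd f K e \<subseteq> S"
        using bspec[OF conjunct2[OF bspec[OF U f(2)]] f(1)] by (elim exE conjE)
      then have "HD_nbhd f K e \<subseteq> \<Union>\<U>"
        using f(2) by blast
      with K(1-3) show "\<exists>K e. compact K \<and> K \<subseteq> unit_disc \<and> e > 0 \<and> HD_nbhd f K e \<subseteq> \<Union>\<U>"
        by (intro exI conjI)
    qed
  qed
  then show ?thesis
    unfolding HD_topology_def by simp
qed

lemma topspace_HD_topology [simp]: "topspace HD_topology = HD"
proof -
  have "openin HD_topology HD"
    unfolding openin_HD_topology
  proof (intro conjI ballI)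
    show "\<exists>K e. compact K \<and> K \<subseteq> unit_disc \<and> e > 0 \<and> HD_nbhd f K e \<subseteq> HD" for f
      by (rule exI[of _ "{}"], rule exI[of _ 1]) (simp add: HD_nbhd_def)
  qed simp
  moreover have "topspace HD_topology \<subseteq> HD"
    using openin_topspace[of HD_topology] unfolding openin_HD_topology by blast
  ultimately show ?thesis
    by (simp add: openin_subset subset_antisym)
qed

definition HD_operators :: "((complex \<Rightarrow> complex) \<Rightarrow> complex \<Rightarrow> complex) set"
  where "HD_operators = {T. continuous_map HD_topology HD_topology T \<and>
    (\<forall>f\<in>HD. \<forall>g\<in>HD. T (f + g) = T f + T g) \<and>
    (\<forall>c. \<forall>f\<in>HD. T (cscale c f) = cscale c (T f))}"

definition norm_on :: "(complex \<Rightarrow> complex) set \<Rightarrow> ((complex \<Rightarrow> complex) \<Rightarrow> real) \<Rightarrow> bool"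
  where "norm_on V p \<longleftrightarrow>
    (\<forall>f\<in>V. 0 \<le> p f) \<and>
    (\<forall>f\<in>V. p f = 0 \<longleftrightarrow> f = 0) \<and>
    (\<forall>c. \<forall>f\<in>V. p (cscale c f) = cmod c * p f) \<and>
    (\<forall>f\<in>V. \<forall>g\<in>V. p (f + g) \<le> p f + p g)"

text \<open>The metric induced by \<open>p\<close> on \<open>V\<close>; \<open>Metric_space\<close> wants
  nonnegativity and symmetry off the carrier as well, hence the value \<open>0\<close> there.\<close>

definition norm_dist :: "(complex \<Rightarrow> complex) set \<Rightarrow> ((complex \<Rightarrow> complex) \<Rightarrow> real) \<Rightarrow>
    (complex \<Rightarrow> complex) \<Rightarrow> (complex \<Rightarrow> complex) \<Rightarrow> real"
  where "norm_dist V p f g = (if f \<in> V \<and> g \<in> V then p (f - g) else 0)"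

lemma Metric_space_norm_dist:
  assumes V: "cfun.subspace V" and p: "norm_on V p"
  shows "Metric_space V (norm_dist V p)"
proof
  have diff: "f - g \<in> V" if "f \<in> V" "g \<in> V" for f g
    by (rule cfun.subspace_diff[OF V that])
  note N = p[unfolded norm_on_def]
  have nonneg: "0 \<le> p f" if "f \<in> V" for f
    by (rule bspec[OF conjunct1[OF N] that])
  have zero: "p f = 0 \<longleftrightarrow> f = 0" if "f \<in> V" for f
    by (rule bspec[OF conjunct1[OF conjunct2[OF N]] that])
  have scale: "p (cscale c f) = cmod c * p f" if "f \<in> V" for c f
    by (rule bspec[OF spec[OF conjunct1[OF conjunct2[OF conjunct2[OF N]]]] that])
  have add: "p (f + g) \<le> p f + p g" if "f \<in> V" "g \<in> V" for f g
    by (rule bspec[OF bspec[OF conjunct2[OF conjunct2[OF conjunct2[OF N]]] that(1)] that(2)])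
  show "0 \<le> norm_dist V p f g" for f g
    by (simp add: norm_dist_def nonneg diff)
  show "norm_dist V p f g = norm_dist V p g f" for f g
  proof (cases "f \<in> V \<and> g \<in> V")
    case True
    have "cscale (-1) (f - g) = g - f"
      by (rule ext) (simp add: cscale_def)
    then show ?thesis
      using True scale[OF diff[of f g], of "-1"] by (simp add: norm_dist_def)
  next
    case False
    then show ?thesis by (simp only: norm_dist_def conj_commute if_False)
  qed
  show "norm_dist V p f g = 0 \<longleftrightarrow> f = g" if "f \<in> V" "g \<in> V" for f g
    using zero[OF diff[OF that]] that by (simp add: norm_dist_def)
  show "norm_dist V p f h \<le> norm_dist V p f g + norm_dist V p g h"
    if "f \<in> V" "g \<in> V" "h \<in> V" for f g h
    using add[OF diff[of f g] diff[of g h]] that by (simp add: norm_dist_def)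
qed

definition banach_on :: "(complex \<Rightarrow> complex) set \<Rightarrow> ((complex \<Rightarrow> complex) \<Rightarrow> real) \<Rightarrow> bool"
  where "banach_on V p \<longleftrightarrow>
    cfun.subspace V \<and> norm_on V p \<and> Metric_space.mcomplete V (norm_dist V p)"

definition banach_space_of_analytic_functions ::
    "(complex \<Rightarrow> complex) set \<Rightarrow> ((complex \<Rightarrow> complex) \<Rightarrow> real) \<Rightarrow> bool"
  where "banach_space_of_analytic_functions X p \<longleftrightarrow>
    X \<subseteq> HD \<and> banach_on X p \<and>
    continuous_map (Metric_space.mtopology X (norm_dist X p)) HD_topology id"

definition optimal_domain :: "((complex \<Rightarrow> complex) \<Rightarrow> complex \<Rightarrow> complex) \<Rightarrow>
    (complex \<Rightarrow> complex) set \<Rightarrow> (complex \<Rightarrow> complex) set"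
  where "optimal_domain T X = {f \<in> HD. T f \<in> X}"

definition optimal_norm :: "((complex \<Rightarrow> complex) \<Rightarrow> complex \<Rightarrow> complex) \<Rightarrow>
    ((complex \<Rightarrow> complex) \<Rightarrow> real) \<Rightarrow> (complex \<Rightarrow> complex) \<Rightarrow> real"
  where "optimal_norm T p f = p (T f)"

text \<open>The norm \<open>q\<close> of \<open>Z\<close> is part of the data of the space; the inclusions
  are inclusions of sets.\<close>

definition admissible :: "((complex \<Rightarrow> complex) \<Rightarrow> complex \<Rightarrow> complex) \<Rightarrow>
    (complex \<Rightarrow> complex) set \<Rightarrow> (complex \<Rightarrow> complex) set \<Rightarrow>
    ((complex \<Rightarrow> complex) \<Rightarrow> real) \<Rightarrow> bool"
  where "admissible T X Z q \<longleftrightarrow>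
    banach_space_of_analytic_functions Z q \<and> T ` Z \<subseteq> X \<and> X \<subseteq> Z"

end

(* T is injective on its optimal domain because the seminorm there is a norm, and this makes the
   inclusion of [T,X] into H(D) an operator with closed graph. The only real work is a closed graph
   theorem from a Banach space into the Frechet space H(D): by Baire, a small element f of the
   Banach space is, for every k, almost in the set of functions bounded by 1 on the k-th disc of an
   exhaustion. Correcting the error successively on larger and larger discs gives partial sums
   converging to f in the Banach norm and to a function bounded by 2 on the k-th disc in H(D);
   closedness of the graph identifies the two limits. *)

theory Submission
  imports Defs "HOL-Complex_Analysis.Cauchy_Integral_Formula"
begin

section \<open>Exhaustion of the disc by compact discs\<close>

definition disc_exhaustion :: "nat \<Rightarrow> complex set"
  where "disc_exhaustion k = cball 0 (1 - inverse (real (Suc k)))"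

lemma compact_disc_exhaustion: "compact (disc_exhaustion k)"
  by (simp add: disc_exhaustion_def)

lemma disc_exhaustion_subset: "disc_exhaustion k \<subseteq> unit_disc"
proof
  fix z assume "z \<in> disc_exhaustion k"
  moreover have "inverse (real (Suc k)) > 0" by simp
  ultimately show "z \<in> unit_disc"
    unfolding disc_exhaustion_def unit_disc_def mem_cball_0 mem_ball_0 by linarith
qed

lemma disc_exhaustion_mono: "j \<le> k \<Longrightarrow> disc_exhaustion j \<subseteq> disc_exhaustion k"
proof -
  assume "j \<le> k"
  then have "inverse (real (Suc k)) \<le> inverse (real (Suc j))"
    by (intro le_imp_inverse_le) auto
  then show ?thesis
    unfolding disc_exhaustion_def by (intro subset_cball) linarith
qed

text \<open>The modulus attains its maximum on \<open>K\<close>, and that maximum is below 1. Hence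
  a countable increasing family of discs suffices to describe the topology of
  \<open>HD\<close>.\<close>

lemma compact_subset_disc_exhaustion:
  assumes "compact K" "K \<subseteq> unit_disc"
  obtains k where "K \<subseteq> disc_exhaustion k"
proof (cases "K = {}")
  case True
  then show ?thesis using that by blast
next
  case False
  obtain w where w: "w \<in> K" "\<And>z. z \<in> K \<Longrightarrow> norm z \<le> norm w"
    using continuous_attains_sup[OF assms(1) False, of norm] by (auto intro: continuous_intros)
  then have "norm w < 1"
    using assms(2) by (auto simp: unit_disc_def)
  then obtain k where k: "inverse (real (Suc k)) < 1 - norm w"
    using reals_Archimedean[of "1 - norm w"] by auto
  have "K \<subseteq> disc_exhaustion k"
    unfolding disc_exhaustion_def using w(2) k by (force simp del: of_nat_Suc)
  then show ?thesis by (rule that)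
qed

lemma disc_exhaustion_cover:
  assumes "z \<in> unit_disc"
  obtains k where "z \<in> disc_exhaustion k"
  using compact_subset_disc_exhaustion[of "{z}"] assms by auto

section \<open>Boundedness and sequential limits in \<open>HD\<close>\<close>

lemma subspace_HD: "cfun.subspace HD"
  unfolding cfun.subspace_def HD_def
  by (auto simp: cscale_def zero_fun_def plus_fun_def intro!: holomorphic_intros)

lemma HD_bounded_on_compact:
  assumes "f \<in> HD" "compact K" "K \<subseteq> unit_disc"
  obtains n where "\<And>z. z \<in> K \<Longrightarrow> norm (f z) \<le> real (Suc n)"
proof -
  have "continuous_on K f"
    using assms holomorphic_on_imp_continuous_on continuous_on_subset
    unfolding HD_def by blast
  then have "bounded (f ` K)"
    using assms(2) compact_continuous_image compact_imp_bounded by blast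
  then obtain B where B: "\<And>z. z \<in> K \<Longrightarrow> norm (f z) \<le> B"
    by (auto simp: bounded_iff)
  obtain n where "B \<le> real n"
    using real_arch_simple by blast
  then have "norm (f z) \<le> real (Suc n)" if "z \<in> K" for z
    using B[OF that] by simp
  then show ?thesis by (rule that)
qed

text \<open>Singletons are compact, so evaluation at a point of the disc is continuous;
  \<open>?U\<close> below is the preimage of a ball under it.\<close>

lemma limitin_HD_topology_pointwise:
  assumes "limitin HD_topology u g sequentially" "z \<in> unit_disc"
  shows "(\<lambda>n. u n z) \<longlonglongrightarrow> g z"
proof (rule metric_LIMSEQ_I)
  fix e :: real assume "e > 0"
  let ?U = "{h \<in> HD. norm (h z - g z) < e}"
  have "openin HD_topology ?U"
    unfolding openin_HD_topology
  proof (intro conjI ballI)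
    fix f assume f: "f \<in> ?U"
    have "HD_nbhd f {z} (e - norm (f z - g z)) \<subseteq> ?U"
    proof
      fix h assume "h \<in> HD_nbhd f {z} (e - norm (f z - g z))"
      then have h: "h \<in> HD" "norm (h z - f z) < e - norm (f z - g z)"
        by (auto simp: HD_nbhd_def)
      have "norm (h z - g z) \<le> norm (h z - f z) + norm (f z - g z)"
        using norm_triangle_ineq[of "h z - f z" "f z - g z"] by simp
      then show "h \<in> ?U" using h by simp
    qed
    then show "\<exists>K d. compact K \<and> K \<subseteq> unit_disc \<and> d > 0 \<and> HD_nbhd f K d \<subseteq> ?U"
      using f assms(2)
      by (intro exI[of _ "{z}"] exI[of _ "e - norm (f z - g z)"]) auto
  qed auto
  moreover have "g \<in> ?U"
    using assms(1) \<open>e > 0\<close> by (simp add: limitin_sequentially)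
  ultimately obtain N where "\<And>n. n \<ge> N \<Longrightarrow> u n \<in> ?U"
    using assms(1) unfolding limitin_sequentially by meson
  then show "\<exists>N. \<forall>n\<ge>N. dist (u n z) (g z) < e"
    by (auto simp: dist_norm)
qed

lemma limitin_HD_topologyI:
  assumes "g \<in> HD" "\<And>n. u n \<in> HD"
    and "\<And>K. compact K \<Longrightarrow> K \<subseteq> unit_disc \<Longrightarrow> uniform_limit K u g sequentially"
  shows "limitin HD_topology u g sequentially"
  unfolding limitin_def
proof (intro conjI allI impI)
  show "g \<in> topspace HD_topology" using assms(1) by simp
  fix U assume "openin HD_topology U \<and> g \<in> U"
  then obtain K e where K: "compact K" "K \<subseteq> unit_disc" "e > 0" "HD_nbhd g K e \<subseteq> U"
    unfolding openin_HD_topology by blast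
  have "\<forall>\<^sub>F n in sequentially. \<forall>z\<in>K. dist (u n z) (g z) < e"
    using assms(3)[OF K(1,2)] K(3) by (simp add: uniform_limit_iff)
  then show "\<forall>\<^sub>F n in sequentially. u n \<in> U"
    by eventually_elim (use K(4) assms(2) in \<open>auto simp: HD_nbhd_def dist_norm\<close>)
qed

text \<open>Pointwise limits are unique on the disc, and members of \<open>HD\<close> vanish off
  it.\<close>

lemma limitin_HD_topology_unique:
  assumes "limitin HD_topology u f sequentially" "limitin HD_topology u g sequentially"
  shows "f = g"
proof
  fix z
  have "f \<in> HD" "g \<in> HD"
    using assms by (simp_all add: limitin_def)
  then show "f z = g z"
    using LIMSEQ_unique[OF assms[THEN limitin_HD_topology_pointwise]]
    by (cases "z \<in> unit_disc") (auto simp: HD_def)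
qed

text \<open>The \<open>n\<close>-th increment is controlled only on disc \<open>k + n\<close>, but
  these discs grow and eventually contain any given compact set, where a geometric series then
  dominates. The case \<open>n = 0\<close> of the error bound yields the constant 2 on disc
  \<open>k\<close>.\<close>

lemma HD_geometric_limit:
  fixes k :: nat
  assumes s: "\<And>n. s n \<in> HD"
    and step: "\<And>n z. z \<in> disc_exhaustion (k + n) \<Longrightarrow> norm (s (Suc n) z - s n z) \<le> (1/2)^n"
  obtains g where "limitin HD_topology s g sequentially"
    and "\<And>n z. z \<in> disc_exhaustion (k + n) \<Longrightarrow> norm (g z - s n z) \<le> 2 * (1/2)^n"
proof -
  \<comment> \<open>The right side is the exact partial sum of the geometric series, which makes the
    induction on \<open>j\<close> close.\<close>
  have tail': "norm (s (n + j) z - s n z) \<le> 2 * (1/2)^n - 2 * (1/2)^(n + j)"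
    if z: "z \<in> disc_exhaustion (k + n)" for n j z
  proof (induction j)
    case (Suc j)
    have "z \<in> disc_exhaustion (k + (n + j))"
      using z disc_exhaustion_mono[of "k + n" "k + (n + j)"] by auto
    from step[OF this] have "norm (s (n + Suc j) z - s (n + j) z) \<le> (1/2)^(n + j)"
      by simp
    moreover have "norm (s (n + Suc j) z - s n z)
        \<le> norm (s (n + Suc j) z - s (n + j) z) + norm (s (n + j) z - s n z)"
      using norm_triangle_ineq[of "s (n + Suc j) z - s (n + j) z" "s (n + j) z - s n z"] by simp
    ultimately show ?case using Suc.IH by simp
  qed simp
  have tail: "norm (s m z - s n z) \<le> 2 * (1/2)^n"
    if z: "z \<in> disc_exhaustion (k + n)" and nm: "n \<le> m" for m n z
  proof -
    obtain j where m: "m = n + j" using nm le_Suc_ex by blast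
    have "(0::real) \<le> 2 * (1/2)^(n + j)" by simp
    then show ?thesis using tail'[OF z, of j] unfolding m by linarith
  qed
  \<comment> \<open>\<open>N\<close> does two jobs: it makes the error smaller than
    \<open>e\<close>, and \<open>N \<ge> M\<close> places disc \<open>M\<close> inside disc
    \<open>k + n\<close> for all later \<open>n\<close>.\<close>
  have null: "\<exists>N\<ge>M. \<forall>n\<ge>N. 2 * (1/2)^n < e" if "e > 0" for e :: real and M :: nat
  proof -
    have "(\<lambda>n. 2 * (1/2::real)^n) \<longlonglongrightarrow> 2 * 0"
      by (intro tendsto_intros LIMSEQ_power_zero) simp
    then have "\<forall>\<^sub>F n in sequentially. 2 * (1/2::real)^n < e"
      using that by (intro order_tendstoD(2)) simp_all
    then obtain N where N: "\<And>n. n \<ge> N \<Longrightarrow> 2 * (1/2::real)^n < e"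
      by (auto simp: eventually_sequentially)
    then show ?thesis by (intro exI[of _ "max M N"]) auto
  qed
  have conv: "convergent (\<lambda>n. s n z)" if z: "z \<in> unit_disc" for z
  proof -
    obtain M where M: "z \<in> disc_exhaustion M" by (rule disc_exhaustion_cover[OF z])
    have "Cauchy (\<lambda>n. s n z)"
    proof (rule CauchyI')
      fix e :: real assume "e > 0"
      then obtain N where N: "N \<ge> M" "\<forall>n\<ge>N. 2 * (1/2)^n < e" using null by blast
      have "norm (s n z - s m z) < e" if "m \<ge> N" "n > m" for m n
      proof -
        have "z \<in> disc_exhaustion (k + m)"
          using M disc_exhaustion_mono[of M "k + m"] N(1) that(1) by auto
        from tail[OF this, of n] show ?thesis
          using that N(2) by force
      qed
      then show "\<exists>N. \<forall>m\<ge>N. \<forall>n>m. dist (s m z) (s n z) < e"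
        by (metis dist_norm norm_minus_commute)
    qed
    then show ?thesis by (rule Cauchy_convergent)
  qed
  define g where "g = (\<lambda>z. if z \<in> unit_disc then lim (\<lambda>n. s n z) else 0)"
  have g: "(\<lambda>n. s n z) \<longlonglongrightarrow> g z" if "z \<in> unit_disc" for z
    using conv[OF that] that by (simp add: g_def convergent_LIMSEQ_iff)
  have close: "norm (g z - s n z) \<le> 2 * (1/2)^n" if z: "z \<in> disc_exhaustion (k + n)" for n z
  proof (rule Lim_bounded)
    show "(\<lambda>m. norm (s m z - s n z)) \<longlonglongrightarrow> norm (g z - s n z)"
      by (intro tendsto_intros g subsetD[OF disc_exhaustion_subset z])
    show "\<forall>m\<ge>n. norm (s m z - s n z) \<le> 2 * (1/2)^n"
      using tail[OF z] by blast
  qed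
  have unif: "uniform_limit K s g sequentially" if K: "compact K" "K \<subseteq> unit_disc" for K
    unfolding uniform_limit_iff
  proof (intro allI impI)
    fix e :: real assume "e > 0"
    obtain M where M: "K \<subseteq> disc_exhaustion M" by (rule compact_subset_disc_exhaustion[OF K])
    obtain N where N: "N \<ge> M" "\<forall>n\<ge>N. 2 * (1/2)^n < e" using null \<open>e > 0\<close> by blast
    have "dist (s n z) (g z) < e" if "n \<ge> N" "z \<in> K" for n z
    proof -
      have "z \<in> disc_exhaustion (k + n)"
        using that M N(1) disc_exhaustion_mono[of M "k + n"] by auto
      from close[OF this] show ?thesis
        using N(2) that(1) by (force simp: dist_norm norm_minus_commute)
    qed
    then show "\<forall>\<^sub>F n in sequentially. \<forall>z\<in>K. dist (s n z) (g z) < e"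
      unfolding eventually_sequentially by blast
  qed
  \<comment> \<open>Weierstrass: every point of the disc has a closed disc around it inside
    \<open>unit_disc\<close>, on which the convergence is uniform.\<close>
  have "g holomorphic_on unit_disc"
  proof (rule holomorphic_uniform_sequence)
    show "open unit_disc" by (simp add: unit_disc_def)
    then show "\<exists>d>0. cball z d \<subseteq> unit_disc \<and> uniform_limit (cball z d) s g sequentially"
      if "z \<in> unit_disc" for z
      using that unif[OF compact_cball] open_contains_cball by metis
    show "s n holomorphic_on unit_disc" for n
      using s by (simp add: HD_def)
  qed
  then have "g \<in> HD" by (simp add: HD_def g_def)
  then have "limitin HD_topology s g sequentially"
    using s unif by (intro limitin_HD_topologyI)
  then show ?thesis using close by (rule that)
qed

section \<open>Norm identities and the Baire category argument\<close>

lemma norm_on_zero: "norm_on V q \<Longrightarrow> cfun.subspace V \<Longrightarrow> q 0 = 0"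
  using cfun.subspace_0 unfolding norm_on_def by blast

lemma norm_on_diff_commute:
  assumes "norm_on V q" "cfun.subspace V" "f \<in> V" "g \<in> V"
  shows "q (f - g) = q (g - f)"
proof -
  have "f - g = cscale (-1) (g - f)"
    by (rule ext) (simp add: cscale_def)
  moreover have "g - f \<in> V" using cfun.subspace_diff assms by blast
  then have "q (cscale (-1) (g - f)) = norm (-1::complex) * q (g - f)"
    using assms(1) unfolding norm_on_def by blast
  ultimately show ?thesis by simp
qed

lemma norm_on_diff_triangle:
  assumes "norm_on V q" "cfun.subspace V" "f \<in> V" "g \<in> V"
  shows "q (f - g) \<le> q f + q g"
proof -
  have "f - g = f + cscale (-1) g"
    by (rule ext) (simp add: cscale_def)
  moreover have "cscale (-1) g \<in> V"
    using assms by (intro cfun.subspace_scale)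
  ultimately have "q (f - g) \<le> q f + q (cscale (-1) g)"
    using assms unfolding norm_on_def by metis
  also have "q (cscale (-1) g) = q g"
    using assms unfolding norm_on_def by (metis norm_minus_cancel norm_one mult_1)
  finally show ?thesis .
qed

text \<open>The Baire category step: some closure of \<open>{f \<in> V. \<bar>f\<bar> \<le> n on K}\<close> has an interior point;
  differences of approximants move that point to the origin.\<close>

lemma banach_on_nearly_bounded:
  assumes V: "banach_on V q" "V \<subseteq> HD" and K: "compact K" "K \<subseteq> unit_disc"
  obtains d where "d > 0"
    and "\<And>f e. f \<in> V \<Longrightarrow> q f < d \<Longrightarrow> e > 0 \<Longrightarrow> \<exists>h\<in>V. q (f - h) < e \<and> (\<forall>z\<in>K. norm (h z) \<le> 1)"
proof -
  have sub: "cfun.subspace V" and q: "norm_on V q"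
    and compl: "Metric_space.mcomplete V (norm_dist V q)"
    using V(1) by (auto simp: banach_on_def)
  interpret M: Metric_space V "norm_dist V q"
    by (rule Metric_space_norm_dist[OF sub q])
  define B where "B n = {f \<in> V. \<forall>z\<in>K. norm (f z) \<le> real (Suc n)}" for n
  let ?C = "\<lambda>n. M.mtopology closure_of (B n)"
  have "V \<subseteq> \<Union>(range ?C)"
  proof
    fix f assume f: "f \<in> V"
    then obtain n where "\<And>z. z \<in> K \<Longrightarrow> norm (f z) \<le> real (Suc n)"
      using HD_bounded_on_compact[OF _ K] V(2) by blast
    then have "f \<in> B n" using f by (simp add: B_def)
    moreover have "B n \<subseteq> topspace M.mtopology" by (auto simp: B_def)
    ultimately show "f \<in> \<Union>(range ?C)"
      using closure_of_subset by blast
  qed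
  moreover have "\<Union>(range ?C) \<subseteq> V"
    using closure_of_subset_topspace[of M.mtopology] by auto
  ultimately have "\<Union>(range ?C) = V" by blast
  then have "M.mtopology interior_of \<Union>(range ?C) = V"
    using interior_of_topspace[of M.mtopology] by simp
  then have "M.mtopology interior_of \<Union>(range ?C) \<noteq> {}"
    using cfun.subspace_0[OF sub] by blast
  \<comment> \<open>Baire in the complete space \<open>V\<close>: countably many closed sets with
    empty interior have a union with empty interior.\<close>
  then have "\<exists>n. M.mtopology interior_of ?C n \<noteq> {}"
    using M.metric_Baire_category_alt[OF compl, of "range ?C"] by fastforce
  then obtain n where "M.mtopology interior_of ?C n \<noteq> {}" ..
  then obtain f0 r where f0: "f0 \<in> V" and r: "r > 0" "M.mball f0 r \<subseteq> ?C n"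
    by (auto simp: M.metric_interior_of)
  have approx: "\<exists>a\<in>B n. q (f - a) < e" if f: "f \<in> V" "q (f - f0) < r" and e: "e > 0" for f e
  proof -
    have "f \<in> M.mball f0 r"
      using f f0 norm_on_diff_commute[OF q sub] by (simp add: norm_dist_def)
    then have "f \<in> ?C n" using r by blast
    then obtain a where "a \<in> B n" "a \<in> M.mball f e"
      using e unfolding M.metric_closure_of by blast
    then show ?thesis by (auto simp: norm_dist_def)
  qed
  \<comment> \<open>Two members of \<open>B n\<close> differ by at most \<open>c\<close> on
    \<open>K\<close>, so their difference divided by \<open>c\<close> is bounded by 1 there. If
    \<open>q f < r / c\<close>, then \<open>c\<close> times \<open>f\<close>, shifted by
    \<open>f0\<close>, stays in the ball around \<open>f0\<close>.\<close>
  define c where "c = 2 * real (Suc n)"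
  have c: "c > 0" by (simp add: c_def)
  have sc: "q (cscale (of_real t) f) = t * q f" if "f \<in> V" "t > 0" for f t
    using q that by (simp add: norm_on_def)
  show ?thesis
  proof (rule that)
    show "r / c > 0" using r c by simp
    fix f and e :: real assume f: "f \<in> V" "q f < r / c" "e > 0"
    let ?F = "cscale (of_real c) f"
    have F: "?F \<in> V" "?F + f0 \<in> V"
      using f f0 sub by (simp_all add: cfun.subspace_scale cfun.subspace_add)
    have "q (?F + f0 - f0) < r"
      using sc[OF f(1) c] f(2) c by (simp add: field_simps)
    then obtain a where a: "a \<in> B n" "q (?F + f0 - a) < c * e / 2"
      using approx[OF F(2), of "c * e / 2"] f c by auto
    obtain b where b: "b \<in> B n" "q (f0 - b) < c * e / 2"
      using approx[OF f0, of "c * e / 2"] f c r norm_on_zero[OF q sub] by auto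
    have ab: "a \<in> V" "b \<in> V" using a b by (auto simp: B_def)
    let ?h = "cscale (of_real (1/c)) (a - b)"
    have h: "?h \<in> V" using ab sub by (simp add: cfun.subspace_scale cfun.subspace_diff)
    \<comment> \<open>The centre \<open>f0\<close> cancels, and the two errors of at most
      \<open>c * e / 2\<close> add up to what division by \<open>c\<close> turns into
      \<open>e\<close>.\<close>
    have "cscale (of_real c) (f - ?h) = (?F + f0 - a) - (f0 - b)"
      using c by (auto simp: fun_eq_iff cscale_def algebra_simps)
    then have "c * q (f - ?h) = q ((?F + f0 - a) - (f0 - b))"
      using sc[of "f - ?h" c] c h f sub by (simp add: cfun.subspace_diff)
    also have "\<dots> \<le> q (?F + f0 - a) + q (f0 - b)"
      using F f0 ab sub by (intro norm_on_diff_triangle[OF q sub]) (simp_all add: cfun.subspace_diff)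
    also have "\<dots> < c * e" using a b by simp
    finally have "q (f - ?h) < e" using c by simp
    moreover have "norm (?h z) \<le> 1" if "z \<in> K" for z
    proof -
      have "norm (a z - b z) \<le> norm (a z) + norm (b z)" by (rule norm_triangle_ineq4)
      also have "\<dots> \<le> c"
        using a(1) b(1) that by (force simp: B_def c_def)
      finally show ?thesis
        using c by (simp add: cscale_def norm_mult norm_divide field_simps)
    qed
    ultimately show "\<exists>h\<in>V. q (f - h) < e \<and> (\<forall>z\<in>K. norm (h z) \<le> 1)"
      using h by blast
  qed
qed

section \<open>The closed graph theorem for maps into \<open>HD\<close>\<close>

text \<open>Successive approximation, as in the proof of the open mapping theorem, removes the error
  left by \<open>banach_on_nearly_bounded\<close>; summing the corrections only doubles the bound
  1.\<close>

lemma banach_on_closed_graph_bound: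
  assumes V: "banach_on V q" "V \<subseteq> HD"
    and graph: "\<And>u f g. range u \<subseteq> V \<Longrightarrow> f \<in> V \<Longrightarrow> (\<lambda>n. q (u n - f)) \<longlonglongrightarrow> 0 \<Longrightarrow>
      limitin HD_topology u g sequentially \<Longrightarrow> f = g"
  obtains d where "d > 0"
    and "\<And>f z. f \<in> V \<Longrightarrow> q f < d \<Longrightarrow> z \<in> disc_exhaustion k \<Longrightarrow> norm (f z) \<le> 2"
proof -
  have sub: "cfun.subspace V" and q: "norm_on V q"
    using V(1) by (auto simp: banach_on_def)
  have "\<forall>k. \<exists>d>0. \<forall>f\<in>V. \<forall>e>0. q f < d \<longrightarrow>
      (\<exists>h\<in>V. q (f - h) < e \<and> (\<forall>z\<in>disc_exhaustion k. norm (h z) \<le> 1))"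
    using banach_on_nearly_bounded[OF V compact_disc_exhaustion disc_exhaustion_subset] by metis
  then obtain d where d: "\<And>k. d k > 0"
    and approx: "\<And>k f e. f \<in> V \<Longrightarrow> e > 0 \<Longrightarrow> q f < d k \<Longrightarrow>
      \<exists>h\<in>V. q (f - h) < e \<and> (\<forall>z\<in>disc_exhaustion k. norm (h z) \<le> 1)"
    by metis
  have sc: "q (cscale (of_real t) f) = t * q f" if "f \<in> V" "t > 0" for f t
    using q that by (simp add: norm_on_def)
  have "norm (f z) \<le> 2" if f: "f \<in> V" "q f < d k" and z: "z \<in> disc_exhaustion k" for f z
  proof -
    \<comment> \<open>The first bound keeps \<open>2^n\<close> times the remainder
      \<open>f - s\<close> below the threshold \<open>d (k + n)\<close>, so that it can be
      approximated again. The second gives convergence to \<open>f\<close> in \<open>q\<close>; it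
      starts at \<open>n = 1\<close> since \<open>q f\<close> itself may be large.\<close>
    define P where "P n s \<longleftrightarrow> s \<in> V \<and> q (f - s) < (1/2)^n * d (k + n) \<and>
      (n = 0 \<longrightarrow> s = 0) \<and> (n > 0 \<longrightarrow> q (f - s) < (1/2)^n)" for n s
    define Q where "Q n s t \<longleftrightarrow>
      (\<forall>z\<in>disc_exhaustion (k + n). norm (t z - s z) \<le> (1/2)^n)" for n :: nat and s t :: "complex \<Rightarrow> complex"
    have "\<exists>s. \<forall>n. P n (s n) \<and> Q n (s n) (s (Suc n))"
    proof (rule dependent_nat_choice)
      show "\<exists>s. P 0 s"
        using f cfun.subspace_0[OF sub] by (auto simp: P_def)
      fix s n assume s: "P n s"
      \<comment> \<open>Approximating the remainder magnified by \<open>2^n\<close> and shrinking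
        the result by the same factor gives a correction of size at most \<open>(1/2)^n\<close> on
        disc \<open>k + n\<close>.\<close>
      define c :: real where "c = 2^n"
      have c: "c > 0" "(1/2)^n = 1/c" by (simp_all add: c_def power_one_over)
      let ?F = "cscale (of_real c) (f - s)"
      have fs: "f - s \<in> V" using s f sub by (simp add: P_def cfun.subspace_diff)
      then have F: "?F \<in> V" using sub by (simp add: cfun.subspace_scale)
      have "q ?F < d (k + n)"
        using sc[OF fs c(1)] s c by (simp add: P_def field_simps)
      \<comment> \<open>The minimum serves both bounds in \<open>P (Suc n)\<close>, and the factor
        1/2 raises the power from \<open>n\<close> to \<open>Suc n\<close>.\<close>
      moreover have "min 1 (d (k + Suc n)) / 2 > 0" using d by simp
      ultimately obtain h where h: "h \<in> V" "q (?F - h) < min 1 (d (k + Suc n)) / 2"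
        "\<And>z. z \<in> disc_exhaustion (k + n) \<Longrightarrow> norm (h z) \<le> 1"
        using approx[OF F] by blast
      let ?g = "cscale (of_real (1/c)) h"
      have g: "?g \<in> V" "s + ?g \<in> V"
        using h s sub by (simp_all add: P_def cfun.subspace_scale cfun.subspace_add)
      have "cscale (of_real c) (f - (s + ?g)) = ?F - h"
        using c(1) by (auto simp: fun_eq_iff cscale_def algebra_simps)
      then have "c * q (f - (s + ?g)) = q (?F - h)"
        using sc[OF _ c(1), of "f - (s + ?g)"] f g sub by (simp add: cfun.subspace_diff)
      then have "c * q (f - (s + ?g)) < min 1 (d (k + Suc n)) / 2"
        using h(2) by simp
      then have "q (f - (s + ?g)) < (1/c) / 2 * min 1 (d (k + Suc n))"
        using c(1) by (simp add: field_simps)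
      also have "(1/c) / 2 = (1/2)^Suc n" using c(2) by simp
      finally have *: "q (f - (s + ?g)) < (1/2)^Suc n * min 1 (d (k + Suc n))" .
      have "(1/2::real)^Suc n * min 1 (d (k + Suc n)) \<le> (1/2)^Suc n * 1"
        "(1/2::real)^Suc n * min 1 (d (k + Suc n)) \<le> (1/2)^Suc n * d (k + Suc n)"
        by (intro mult_left_mono; simp)+
      with * have "q (f - (s + ?g)) < (1/2)^Suc n" "q (f - (s + ?g)) < (1/2)^Suc n * d (k + Suc n)"
        by linarith+
      then have "P (Suc n) (s + ?g)"
        using g by (simp add: P_def)
      moreover have "Q n s (s + ?g)"
        using h(3) c by (auto simp: Q_def cscale_def norm_mult norm_divide field_simps)
      ultimately show "\<exists>t. P (Suc n) t \<and> Q n s t" by blast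
    qed
    then obtain s where s: "\<And>n. P n (s n)" "\<And>n. Q n (s n) (s (Suc n))" by blast
    have sV: "s n \<in> V" for n using s(1) by (simp add: P_def)
    obtain g where g: "limitin HD_topology s g sequentially"
      "\<And>n z. z \<in> disc_exhaustion (k + n) \<Longrightarrow> norm (g z - s n z) \<le> 2 * (1/2)^n"
      using HD_geometric_limit[of s k] sV V(2) s(2) unfolding Q_def by blast
    have "(\<lambda>n. q (s n - f)) \<longlonglongrightarrow> 0"
    proof (rule tendsto_sandwich)
      show "\<forall>\<^sub>F n in sequentially. 0 \<le> q (s n - f)"
        using q sV f sub by (simp add: norm_on_def cfun.subspace_diff)
      have "q (s n - f) \<le> (1/2)^n" if "n > 0" for n
        using s(1)[of n] that norm_on_diff_commute[OF q sub sV f(1)] by (simp add: P_def)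
      then show "\<forall>\<^sub>F n in sequentially. q (s n - f) \<le> (1/2)^n"
        using eventually_gt_at_top[of 0] by (rule eventually_mono[rotated]) auto
      show "(\<lambda>n. (1/2::real)^n) \<longlonglongrightarrow> 0" by (rule LIMSEQ_power_zero) simp
    qed simp
    then have "f = g" using graph[of s] sV f(1) g(1) by blast
    \<comment> \<open>Since \<open>s 0 = 0\<close>, the error bound at \<open>n = 0\<close> is a
      bound for \<open>g\<close>, that is, for \<open>f\<close>.\<close>
    then show ?thesis using g(2)[of z 0] s(1)[of 0] z by (simp add: P_def)
  qed
  then show ?thesis using d[of k] that by blast
qed

text \<open>Homogeneity turns the bound on a small ball into continuity at the origin, and
  translation gives continuity everywhere. Closedness of the graph enters in sequential form: limits
  in \<open>q\<close> and in \<open>HD\<close> agree.\<close>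

theorem banach_on_closed_graph:
  assumes V: "banach_on V q" "V \<subseteq> HD"
    and graph: "\<And>u f g. range u \<subseteq> V \<Longrightarrow> f \<in> V \<Longrightarrow> (\<lambda>n. q (u n - f)) \<longlonglongrightarrow> 0 \<Longrightarrow>
      limitin HD_topology u g sequentially \<Longrightarrow> f = g"
  shows "continuous_map (Metric_space.mtopology V (norm_dist V q)) HD_topology id"
proof -
  have sub: "cfun.subspace V" and q: "norm_on V q"
    using V(1) by (auto simp: banach_on_def)
  interpret M: Metric_space V "norm_dist V q"
    by (rule Metric_space_norm_dist[OF sub q])
  have "openin M.mtopology {f \<in> V. f \<in> U}" if U: "openin HD_topology U" for U
    unfolding M.openin_mtopology
  proof (intro conjI allI impI)
    fix f assume f: "f \<in> {f \<in> V. f \<in> U}"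
    then obtain K e where K: "compact K" "K \<subseteq> unit_disc" "e > 0" "HD_nbhd f K e \<subseteq> U"
      using U unfolding openin_HD_topology by blast
    obtain k where k: "K \<subseteq> disc_exhaustion k" by (rule compact_subset_disc_exhaustion[OF K(1,2)])
    obtain d where d: "d > 0"
      "\<And>f z. f \<in> V \<Longrightarrow> q f < d \<Longrightarrow> z \<in> disc_exhaustion k \<Longrightarrow> norm (f z) \<le> 2"
      by (rule banach_on_closed_graph_bound[OF V graph, where k = k]) blast+
    \<comment> \<open>Scaling by \<open>4 / e\<close> carries the radius \<open>d * e / 4\<close> to
      \<open>d\<close>; the bound 2 then scales back to \<open>e / 2\<close>, which is strictly
      below \<open>e\<close>.\<close>
    have "g \<in> U" if g: "g \<in> V" "q (f - g) < d * e / 4" for g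
    proof -
      let ?h = "cscale (of_real (4 / e)) (g - f)"
      have gf: "g - f \<in> V" using f g sub by (simp add: cfun.subspace_diff)
      then have h: "?h \<in> V" using sub by (simp add: cfun.subspace_scale)
      have "q ?h = 4 / e * q (g - f)"
        using q gf K(3) by (simp add: norm_on_def norm_divide)
      also have "\<dots> < d"
        using g(2) norm_on_diff_commute[OF q sub, of f g] f g(1) K(3) by (simp add: field_simps)
      finally have "q ?h < d" .
      then have le2: "norm (?h z) \<le> 2" if "z \<in> K" for z
        using d(2)[OF h] k that by blast
      have "norm (g z - f z) < e" if "z \<in> K" for z
      proof -
        have "norm (?h z) = 4 / e * norm (g z - f z)"
          using K(3) norm_mult[of "of_real (4 / e)" "g z - f z"]
          by (simp add: cscale_def right_diff_distrib norm_divide)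
        then have "4 / e * norm (g z - f z) \<le> 2"
          using le2[OF that] by (simp only:)
        then have "4 * norm (g z - f z) \<le> 2 * e"
          using K(3) by (simp add: field_simps)
        then show ?thesis using K(3) by linarith
      qed
      then have "g \<in> HD_nbhd f K e" using g V(2) by (auto simp: HD_nbhd_def)
      then show ?thesis using K(4) by blast
    qed
    then have "M.mball f (d * e / 4) \<subseteq> {f \<in> V. f \<in> U}"
      by (auto simp: norm_dist_def)
    then show "\<exists>r>0. M.mball f r \<subseteq> {f \<in> V. f \<in> U}"
      using d(1) K(3) by (intro exI[of _ "d * e / 4"]) simp
  qed simp
  then show ?thesis
    using V(2) by (auto simp: continuous_map_def)
qed

section \<open>The optimal domain\<close>

lemma HD_operators_diff:
  assumes "T \<in> HD_operators" "f \<in> HD" "g \<in> HD"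
  shows "T (f - g) = T f - T g"
proof -
  have eq: "h - k = h + cscale (-1) k" for h k
    by (rule ext) (simp add: cscale_def)
  have "cscale (-1) g \<in> HD"
    using assms(3) by (rule cfun.subspace_scale[OF subspace_HD])
  then have "T (f + cscale (-1) g) = T f + cscale (-1) (T g)"
    using assms unfolding HD_operators_def by (smt (verit) mem_Collect_eq)
  then show ?thesis unfolding eq .
qed

theorem proposition2p5:
  fixes X :: "(complex \<Rightarrow> complex) set"
    and p :: "(complex \<Rightarrow> complex) \<Rightarrow> real"
    and T :: "(complex \<Rightarrow> complex) \<Rightarrow> complex \<Rightarrow> complex"
  assumes "banach_space_of_analytic_functions X p"
    and "T \<in> HD_operators"
    and "T ` X \<subseteq> X"
    and "banach_on (optimal_domain T X) (optimal_norm T p)"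
  shows "admissible T X (optimal_domain T X) (optimal_norm T p) \<and>
    (\<forall>Z q. admissible T X Z q \<longrightarrow> Z \<subseteq> optimal_domain T X)"
proof -
  let ?V = "optimal_domain T X" and ?q = "optimal_norm T p"
  have X: "X \<subseteq> HD" "cfun.subspace X" "norm_on X p"
    and incl: "continuous_map (Metric_space.mtopology X (norm_dist X p)) HD_topology id"
    using assms(1) by (auto simp: banach_space_of_analytic_functions_def banach_on_def)
  interpret M: Metric_space X "norm_dist X p"
    by (rule Metric_space_norm_dist[OF X(2,3)])
  have T: "continuous_map HD_topology HD_topology T"
    using assms(2) by (simp add: HD_operators_def)
  have V: "?V \<subseteq> HD" by (auto simp: optimal_domain_def)
  have "continuous_map (Metric_space.mtopology ?V (norm_dist ?V ?q)) HD_topology id"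
  proof (rule banach_on_closed_graph[OF assms(4) V])
    fix u f g
    assume u: "range u \<subseteq> ?V" and f: "f \<in> ?V" and uf: "(\<lambda>n. ?q (u n - f)) \<longlonglongrightarrow> 0"
      and ug: "limitin HD_topology u g sequentially"
    have uV: "u n \<in> ?V" for n using u by blast
    then have Tu: "T (u n) \<in> X" and Tf: "T f \<in> X" for n
      using f by (auto simp: optimal_domain_def)
    \<comment> \<open>By linearity \<open>T\<close> preserves distances from the optimal domain to
      \<open>X\<close>, so \<open>T (u n)\<close> tends to \<open>T f\<close> in \<open>X\<close>,
      and hence in \<open>HD\<close>.\<close>
    have "norm_dist X p (T (u n)) (T f) = ?q (u n - f)" for n
      using Tu Tf uV f V HD_operators_diff[OF assms(2)]
      by (simp add: norm_dist_def optimal_norm_def subset_iff)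
    then have "(\<lambda>n. norm_dist X p (T (u n)) (T f)) \<longlonglongrightarrow> 0"
      using uf by simp
    then have "limitin M.mtopology (\<lambda>n. T (u n)) (T f) sequentially"
      using Tu Tf by (simp add: M.limitin_metric_dist_null)
    then have "limitin HD_topology (\<lambda>n. T (u n)) (T f) sequentially"
      using continuous_map_limit[OF incl] by (simp add: o_def)
    moreover have "limitin HD_topology (\<lambda>n. T (u n)) (T g) sequentially"
      using continuous_map_limit[OF T ug] by (simp add: o_def)
    ultimately have eq: "T f = T g" by (rule limitin_HD_topology_unique)
    \<comment> \<open>The limit \<open>g\<close> is known only to lie in \<open>HD\<close>;
      \<open>T g = T f\<close> puts it into the optimal domain, where definiteness of the norm
      applies to \<open>f - g\<close>.\<close>
    have "g \<in> HD" using ug by (simp add: limitin_def)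
    then have g: "g \<in> ?V" using Tf eq by (simp add: optimal_domain_def)
    have sub: "cfun.subspace ?V" and q: "norm_on ?V ?q"
      using assms(4) by (auto simp: banach_on_def)
    have "T (f - g) = 0"
      using eq HD_operators_diff[OF assms(2), of f g] f g V by auto
    then have "?q (f - g) = 0"
      using norm_on_zero[OF X(3,2)] by (simp add: optimal_norm_def)
    then have "f - g = 0"
      using q cfun.subspace_diff[OF sub f g] by (simp add: norm_on_def)
    then show "f = g" by simp
  qed
  \<comment> \<open>With continuity of the inclusion settled, \<open>T\<close> X \<subseteq>
    X\<open>and\<close>X \<subseteq>
    HD\<open>place\<close>X\<open>inside the optimal domain. Maximality is then immediate from\<close>T
    \<open>Z \<subseteq> X\<close> and \<open>Z \<subseteq> HD\<close>.\<close>
  then have "admissible T X ?V ?q"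
    using assms(3,4) X(1) V
    by (auto simp: admissible_def banach_space_of_analytic_functions_def optimal_domain_def)
  moreover have "Z \<subseteq> ?V" if "admissible T X Z q" for Z q
    using that by (auto simp: admissible_def banach_space_of_analytic_functions_def optimal_domain_def)
  ultimately show ?thesis by blast
qed

end
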